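(* Let $X$ be a hyperbolic Riemann surface and let $\mathscr{F}$ be a subfamily of $\mathrm{Hol}(X,X)$ for which $\overline{\mathscr{F}}$ does not contain any periodic or pseudoperiodic automorphisms of $X$. Let $f_n\in\mathscr{F}$ for $n\ge1$ and suppose that the left iterated function system $L_n=f_n\circ f_{n-1}\circ\dots\circ f_1$ is relatively compact in $\mathrm{Hol}(X,X)$. Suppose also that each map $f_n$ has a fixed point $a_n\in X$ and that $a_n\to a\in X$. Then $\{L_n\}$ converges to the constant map with value $a$.
   Context: $\mathrm{Hol}(X,X)$ is the space of holomorphic self-maps of $X$ with the compact-open topology, so convergence is uniform convergence on compact subsets of $X$; $\overline{\mathscr{F}}$ is the closure of $\mathscr{F}$ in $\mathrm{Hol}(X,X)$. A sequence is relatively compact in $\mathrm{Hol}(X,X)$ if its closure there is compact. An automorphism $f$ of $X$ is periodic if $f^p=\mathrm{id}_X$ for some integer $p\ge1$ (in particular, $\mathrm{id}_X$ is periodic); it is pseudoperiodic if it is not periodic and $\mathrm{id}_X$ is a limit point (limit of a subsequence) of the sequence of iterates $\{f^n\}$. *)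

theory Defs
  imports "HOL-Analysis.Analysis"
begin

section \<open>Riemann surfaces\<close>

type_synonym 'a complex_atlas = "('a set \<times> ('a \<Rightarrow> complex)) set"

text \<open>A surface is given by a carrier set with its subspace topology and an atlas of charts
  \<open>(U, \<phi>)\<close>, where only the values of \<open>\<phi>\<close> on \<open>U\<close> matter. The atlas need not be maximal.
  Second countability is not required: by Rado's theorem it is automatic.\<close>

definition complex_chart :: "'a::topological_space set \<Rightarrow> 'a set \<Rightarrow> ('a \<Rightarrow> complex) \<Rightarrow> bool" where
  "complex_chart X U \<phi> \<longleftrightarrow>
     openin (top_of_set X) U \<and> open (\<phi> ` U) \<and> homeomorphism U (\<phi> ` U) \<phi> (inv_into U \<phi>)"

definition riemann_surface :: "'a::topological_space set \<Rightarrow> 'a complex_atlas \<Rightarrow> bool" where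
  "riemann_surface X A \<longleftrightarrow>
     X \<noteq> {} \<and> connected X \<and> Hausdorff_space (top_of_set X) \<and>
     (\<forall>(U, \<phi>) \<in> A. complex_chart X U \<phi>) \<and>
     \<Union> (fst ` A) = X \<and>
     (\<forall>(U, \<phi>) \<in> A. \<forall>(V, \<psi>) \<in> A. (\<psi> \<circ> inv_into U \<phi>) holomorphic_on \<phi> ` (U \<inter> V))"

definition holomorphic_map ::
    "'a::topological_space set \<Rightarrow> 'a complex_atlas \<Rightarrow>
     'b::topological_space set \<Rightarrow> 'b complex_atlas \<Rightarrow> ('a \<Rightarrow> 'b) \<Rightarrow> bool" where
  "holomorphic_map X A Y B f \<longleftrightarrow>
     f \<in> X \<rightarrow> Y \<and> continuous_on X f \<and>
     (\<forall>(U, \<phi>) \<in> A. \<forall>(V, \<psi>) \<in> B.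
        (\<psi> \<circ> f \<circ> inv_into U \<phi>) holomorphic_on \<phi> ` (U \<inter> f -` V))"

abbreviation unit_disc :: "complex set" where
  "unit_disc \<equiv> ball 0 1"

abbreviation unit_disc_atlas :: "complex complex_atlas" where
  "unit_disc_atlas \<equiv> {(unit_disc, \<lambda>z. z)}"

text \<open>A Riemann surface is hyperbolic if its universal covering surface is the unit disc.
  As the disc is simply connected, any holomorphic covering by the disc is universal.\<close>

definition hyperbolic_surface :: "'a::topological_space set \<Rightarrow> 'a complex_atlas \<Rightarrow> bool" where
  "hyperbolic_surface X A \<longleftrightarrow>
     riemann_surface X A \<and>
     (\<exists>p. covering_space unit_disc p X \<and>
          holomorphic_map unit_disc unit_disc_atlas X A p)"


section \<open>Holomorphic self-maps with the compact-open topology\<close>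

text \<open>Self-maps of \<open>X\<close> are represented extensionally (they are \<open>undefined\<close> off \<open>X\<close>), so that
  equality of functions is equality of maps on \<open>X\<close>.\<close>

definition Hol :: "'a::topological_space set \<Rightarrow> 'a complex_atlas \<Rightarrow> ('a \<Rightarrow> 'a) set" where
  "Hol X A = {f \<in> extensional X. holomorphic_map X A X A f}"

definition Hol_topology ::
    "'a::topological_space set \<Rightarrow> 'a complex_atlas \<Rightarrow> ('a \<Rightarrow> 'a) topology" where
  "Hol_topology X A = topology_generated_by
     {{f \<in> Hol X A. f ` K \<subseteq> U} | K U. compact K \<and> K \<subseteq> X \<and> openin (top_of_set X) U}"

lemma topspace_Hol_topology [simp]: "topspace (Hol_topology X A) = Hol X A"
proof -
  have "Hol X A \<in> {{f \<in> Hol X A. f ` K \<subseteq> U} | K U.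
      compact K \<and> K \<subseteq> X \<and> openin (top_of_set X) U}"
    by (rule CollectI, rule exI[of _ "{}"], rule exI[of _ "{}"]) auto
  then show ?thesis
    unfolding Hol_topology_def topology_generated_by_topspace by blast
qed

definition identity_map :: "'a set \<Rightarrow> 'a \<Rightarrow> 'a" where
  "identity_map X = (\<lambda>x\<in>X. x)"

definition iterate :: "'a set \<Rightarrow> ('a \<Rightarrow> 'a) \<Rightarrow> nat \<Rightarrow> 'a \<Rightarrow> 'a" where
  "iterate X f n = restrict (f ^^ n) X"

definition holomorphic_automorphism ::
    "'a::topological_space set \<Rightarrow> 'a complex_atlas \<Rightarrow> ('a \<Rightarrow> 'a) \<Rightarrow> bool" where
  "holomorphic_automorphism X A f \<longleftrightarrow>
     f \<in> Hol X A \<and>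
     (\<exists>g \<in> Hol X A. compose X g f = identity_map X \<and> compose X f g = identity_map X)"

definition periodic_automorphism ::
    "'a::topological_space set \<Rightarrow> 'a complex_atlas \<Rightarrow> ('a \<Rightarrow> 'a) \<Rightarrow> bool" where
  "periodic_automorphism X A f \<longleftrightarrow>
     holomorphic_automorphism X A f \<and> (\<exists>p\<ge>1. iterate X f p = identity_map X)"

definition pseudoperiodic_automorphism ::
    "'a::topological_space set \<Rightarrow> 'a complex_atlas \<Rightarrow> ('a \<Rightarrow> 'a) \<Rightarrow> bool" where
  "pseudoperiodic_automorphism X A f \<longleftrightarrow>
     holomorphic_automorphism X A f \<and> \<not> periodic_automorphism X A f \<and>
     (\<exists>r :: nat \<Rightarrow> nat. strict_mono r \<and>
        limitin (Hol_topology X A) (\<lambda>n. iterate X f (r n)) (identity_map X) sequentially)"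

text \<open>\<open>left_ifs X f n\<close> is \<open>f n \<circ> \<dots> \<circ> f 1\<close>; the value \<open>f 0\<close> is not used.\<close>

primrec left_ifs :: "'a set \<Rightarrow> (nat \<Rightarrow> 'a \<Rightarrow> 'a) \<Rightarrow> nat \<Rightarrow> 'a \<Rightarrow> 'a" where
  "left_ifs X f 0 = identity_map X"
| "left_ifs X f (Suc n) = compose X (f (Suc n)) (left_ifs X f n)"

end

theory Submission
  imports Defs "HOL-Complex_Analysis.Complex_Analysis"
begin

text \<open>The argument takes place in the unit disc \<open>D\<close>, with a holomorphic covering \<open>p\<close> of \<open>X\<close> by \<open>D\<close>
  such that \<open>p 0 = a\<close>. The fixed points lift to points \<open>b n\<close> of \<open>D\<close> tending to \<open>0\<close>, and each
  \<open>f n\<close> lifts to a holomorphic self-map \<open>F n\<close> of \<open>D\<close> that fixes \<open>b n\<close>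
  (\<open>convergent_sequence_lift\<close>, \<open>self_map_lift_fixing_point\<close>).

  By Montel's theorem the \<open>F n\<close> form a normal family. Every limit \<open>G\<close> of maps \<open>F n\<close> with \<open>n\<close> tending
  to infinity fixes \<open>0\<close>, so by the Schwarz lemma it either is a rotation or satisfies
  \<open>norm (G z) < norm z\<close> for all \<open>z \<noteq> 0\<close>. A rotation is excluded: limits of lifts descend to limits of
  the maps below (\<open>lifts_converge\<close>), so \<open>G\<close> covers a map \<open>g\<close> in the closure of the family, and since
  suitable powers of a rotation tend to the identity, some iterates of \<open>g\<close> tend to the identity and the
  preceding iterates tend to an inverse of \<open>g\<close>
  (\<open>rotation_lift_imp_periodic_or_pseudoperiodic\<close>). Compactness turns the strict inequality for all
  limits into a uniform one (\<open>eventually_uniform_contraction\<close>): for \<open>r < 1\<close> and \<open>\<epsilon> > 0\<close> there is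
  \<open>\<eta> > 0\<close> such that \<open>norm (F n z) \<le> max \<epsilon> (norm z - \<eta>)\<close> when \<open>norm z \<le> r\<close> and \<open>n\<close> is large.

  Let \<open>K\<close> be compact in \<open>X\<close>, and let \<open>L n\<close> stand for \<open>left_ifs X f n\<close>. Relative compactness of the
  system gives a single \<open>r < 1\<close> such that, for all \<open>n \<ge> 1\<close>, the set \<open>L n ` K\<close> lies in \<open>p ` ball 0 r\<close>. The contraction then pushes these sets into
  \<open>p ` cball 0 (r - \<eta>)\<close>, \<open>p ` cball 0 (r - 2 * \<eta>)\<close>, and so on, and after finitely many steps into
  \<open>p ` cball 0 \<epsilon>\<close>, which is as small a neighbourhood of \<open>a\<close> as desired. The bound \<open>r\<close> has to be
  independent of \<open>n\<close> because the index from which the contraction holds depends on \<open>r\<close>.\<close>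

section \<open>Covering spaces\<close>

lemma covering_space_compose_homeomorphism:
  assumes p: "covering_space C p S" and h: "homeomorphism B C h k"
  shows "covering_space B (\<lambda>x. p (h x)) S"
proof
  have hB: "h ` B = C" and kC: "k ` C = B" and kh: "\<And>x. x \<in> B \<Longrightarrow> k (h x) = x"
    and hk: "\<And>y. y \<in> C \<Longrightarrow> h (k y) = y"
    and ch: "continuous_on B h" and ck: "continuous_on C k"
    using h by (auto simp: homeomorphism_def)
  show "continuous_on B (\<lambda>x. p (h x))"
    using continuous_on_compose2[OF covering_space_imp_continuous[OF p] ch] hB by blast
  show "(\<lambda>x. p (h x)) ` B = S"
    using covering_space_imp_surjective[OF p] hB by (metis image_image)
  fix y assume "y \<in> S"
  then obtain T v where T: "y \<in> T" "openin (top_of_set S) T" and v: "\<Union>v = C \<inter> p -` T"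
    "\<forall>u\<in>v. openin (top_of_set C) u" "pairwise disjnt v" "\<forall>u\<in>v. \<exists>q. homeomorphism u T p q"
    using p unfolding covering_space_def by metis
  let ?pre = "\<lambda>u. B \<inter> h -` u"
  have 1: "\<Union>(?pre ` v) = B \<inter> (\<lambda>x. p (h x)) -` T"
    using v(1) hB by blast
  have 2: "openin (top_of_set B) u'" if "u' \<in> ?pre ` v" for u'
    using that v(2) continuous_openin_preimage[OF ch, of C] hB by blast
  have 3: "pairwise disjnt (?pre ` v)"
    using v(3) by (auto simp: pairwise_def disjnt_def)
  have 4: "\<exists>q. homeomorphism u' T (\<lambda>x. p (h x)) q" if u': "u' \<in> ?pre ` v" for u'
  proof -
    obtain u where u: "u \<in> v" "u' = ?pre u"
      using u' by blast
    then obtain q where q: "homeomorphism u T p q"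
      using v(4) by blast
    have "u \<subseteq> C"
      using u(1) v(1) by blast
    then have "h ` u' = u" "k ` u = u'"
      using u(2) hk kh hB kC by force+
    then have "homeomorphism u' u h k"
      using homeomorphism_of_subsets[OF h, of u' u] u(2) \<open>u \<subseteq> C\<close> by blast
    then show ?thesis
      using homeomorphism_compose[OF _ q] unfolding o_def by blast
  qed
  show "\<exists>T. y \<in> T \<and> openin (top_of_set S) T \<and>
          (\<exists>v. \<Union>v = B \<inter> (\<lambda>x. p (h x)) -` T \<and> (\<forall>u\<in>v. openin (top_of_set B) u) \<and>
             pairwise disjnt v \<and> (\<forall>u\<in>v. \<exists>q. homeomorphism u T (\<lambda>x. p (h x)) q))"
    using T 1 2 3 4 by (intro exI[of _ T] conjI exI[of _ "?pre ` v"]) auto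
qed

text \<open>The total space of a pullback lies in the product of \<open>B\<close> and \<open>C\<close>. This moves lifting problems away
  from the base \<open>S\<close>, about which only its topology is known.\<close>

lemma covering_space_pullback:
  fixes q :: "'b::topological_space \<Rightarrow> 'c::topological_space"
    and p :: "'a::topological_space \<Rightarrow> 'c"
  assumes p: "covering_space C p S" and q: "continuous_on B q" "q \<in> B \<rightarrow> S"
  shows "covering_space {(x, c). x \<in> B \<and> c \<in> C \<and> q x = p c} fst B"
proof
  let ?E = "{(x, c). x \<in> B \<and> c \<in> C \<and> q x = p c}"
  show "continuous_on ?E fst"
    by (intro continuous_intros)
  show "fst ` ?E = B"
  proof
    show "B \<subseteq> fst ` ?E"
    proof
      fix x assume "x \<in> B"
      then obtain c where "c \<in> C" "q x = p c"
        using q(2) covering_space_imp_surjective[OF p] by blast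
      then show "x \<in> fst ` ?E"
        using \<open>x \<in> B\<close> by force
    qed
  qed auto
  fix x assume x: "x \<in> B"
  then obtain T v where T: "q x \<in> T" "openin (top_of_set S) T" and v: "\<Union>v = C \<inter> p -` T"
    "\<forall>u\<in>v. openin (top_of_set C) u" "pairwise disjnt v" "\<forall>u\<in>v. \<exists>q. homeomorphism u T p q"
    using p q(2) unfolding covering_space_def by (metis PiE)
  let ?T = "B \<inter> q -` T" and ?pre = "\<lambda>u. ?E \<inter> snd -` u"
  have 0: "openin (top_of_set B) ?T"
    using continuous_openin_preimage[OF q(1) q(2) T(2)] .
  have "(\<exists>u\<in>v. c \<in> u) \<longleftrightarrow> c \<in> C \<and> p c \<in> T" for c
    using v(1) by (auto simp: set_eq_iff)
  then have 1: "\<Union>(?pre ` v) = ?E \<inter> fst -` ?T"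
    by (auto simp del: vimage_Union) metis+
  have 2: "openin (top_of_set ?E) (?pre u)" if "u \<in> v" for u
    by (rule continuous_openin_preimage[of _ _ C]) (use that v(2) in \<open>auto intro!: continuous_intros\<close>)
  have 3: "pairwise disjnt (?pre ` v)"
    using v(3) by (auto simp: pairwise_def disjnt_def)
  have 4: "\<exists>r. homeomorphism (?pre u) ?T fst r" if u: "u \<in> v" for u
  proof -
    obtain s where s: "homeomorphism u T p s"
      using v(4) u by blast
    have "u \<subseteq> C"
      using u v(1) by blast
    have "homeomorphism (?pre u) ?T fst (\<lambda>x. (x, s (q x)))"
    proof (rule homeomorphismI)
      show "continuous_on (?pre u) fst"
        by (intro continuous_intros)
      have "continuous_on T s"
        using s by (auto simp: homeomorphism_def)
      moreover have "continuous_on ?T q"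
        using q(1) continuous_on_subset by blast
      ultimately show "continuous_on ?T (\<lambda>x. (x, s (q x)))"
        using continuous_on_compose2[of T s ?T q] by (intro continuous_intros) auto
      show "fst ` ?pre u \<subseteq> ?T"
        using u v(1) by auto
      show "(\<lambda>x. (x, s (q x))) ` ?T \<subseteq> ?pre u"
        using s \<open>u \<subseteq> C\<close> by (force simp: homeomorphism_def)
      show "(fst e, s (q (fst e))) = e" if "e \<in> ?pre u" for e
        using that s by (auto simp: homeomorphism_def)
    qed auto
    then show ?thesis by blast
  qed
  show "\<exists>T. x \<in> T \<and> openin (top_of_set B) T \<and>
          (\<exists>v. \<Union>v = ?E \<inter> fst -` T \<and> (\<forall>u\<in>v. openin (top_of_set ?E) u) \<and>
             pairwise disjnt v \<and> (\<forall>u\<in>v. \<exists>q. homeomorphism u T fst q))"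
    using x T 0 1 2 3 4 by (intro exI[of _ ?T] conjI exI[of _ "?pre ` v"]) auto
qed

text \<open>A lift of \<open>q\<close> through \<open>p\<close> is the same as a section of the covering of the disc obtained by pulling
  \<open>p\<close> back along \<open>q\<close>. That covering is a map between subsets of normed spaces, so the lifting theorem
  applies to it, with the identity of the simply connected disc as the map to be lifted.\<close>

lemma disc_lift_exists:
  fixes p :: "complex \<Rightarrow> 'a::topological_space"
  assumes p: "covering_space unit_disc p S"
    and q: "continuous_on unit_disc q" "q \<in> unit_disc \<rightarrow> S"
    and z: "z \<in> unit_disc" "w \<in> unit_disc" "q z = p w"
  obtains F where "continuous_on unit_disc F" "F \<in> unit_disc \<rightarrow> unit_disc" "F z = w"
    "\<And>y. y \<in> unit_disc \<Longrightarrow> p (F y) = q y"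
proof -
  let ?E = "{(x, c). x \<in> unit_disc \<and> c \<in> unit_disc \<and> q x = p c}"
  have cov: "covering_space ?E fst unit_disc"
    using covering_space_pullback[OF p q] .
  obtain G where G: "continuous_on unit_disc G" "G \<in> unit_disc \<rightarrow> ?E" "G z = (z, w)"
    "\<And>y. y \<in> unit_disc \<Longrightarrow> fst (G y) = y"
  proof (rule covering_space_lift_strong[OF cov, where a = "(z, w)" and z = z and U = unit_disc
        and f = "\<lambda>y. y"])
    show "simply_connected unit_disc" "locally path_connected unit_disc"
      by (auto intro: convex_imp_simply_connected convex_imp_locally_path_connected)
  qed (use z in auto)
  show thesis
  proof (rule that[of "\<lambda>y. snd (G y)"])
    show "continuous_on unit_disc (\<lambda>y. snd (G y))"
      using G(1) by (intro continuous_intros)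
    show "(\<lambda>y. snd (G y)) \<in> unit_disc \<rightarrow> unit_disc"
      using G(2) by (force simp: Pi_def)
    show "p (snd (G y)) = q y" if "y \<in> unit_disc" for y
      using G(2) G(4)[of y] that by (force simp: Pi_def)
  qed (use G(3) in auto)
qed

section \<open>Holomorphic maps out of the disc\<close>

lemma holomorphic_on_locally:
  assumes "\<And>z. z \<in> S \<Longrightarrow> \<exists>N. open N \<and> z \<in> N \<and> F holomorphic_on N"
  shows "F holomorphic_on S"
  using assms by (meson field_differentiable_at_within holomorphic_onI holomorphic_on_imp_differentiable_at)

lemma holomorphic_map_disc_iff:
  "holomorphic_map unit_disc unit_disc_atlas X A h \<longleftrightarrow>
     h \<in> unit_disc \<rightarrow> X \<and> continuous_on unit_disc h \<and>
     (\<forall>(V, \<psi>) \<in> A. (\<lambda>z. \<psi> (h z)) holomorphic_on unit_disc \<inter> h -` V)"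
proof -
  have "inv_into unit_disc (\<lambda>z. z) z = z" if "z \<in> unit_disc" for z :: complex
    by (metis f_inv_into_f image_ident that)
  then have "(\<psi> \<circ> h \<circ> inv_into unit_disc (\<lambda>z. z)) holomorphic_on (\<lambda>z. z) ` (unit_disc \<inter> h -` V) \<longleftrightarrow>
      (\<lambda>z. \<psi> (h z)) holomorphic_on unit_disc \<inter> h -` V" for \<psi> :: "'a \<Rightarrow> complex" and V
    by (intro holomorphic_cong) auto
  then show ?thesis
    unfolding holomorphic_map_def by simp
qed

lemma holomorphic_map_disc_cong:
  assumes h: "holomorphic_map unit_disc unit_disc_atlas X A h"
    and eq: "\<And>z. norm z < 1 \<Longrightarrow> k z = h z"
  shows "holomorphic_map unit_disc unit_disc_atlas X A k"
proof -
  have "unit_disc \<inter> k -` V = unit_disc \<inter> h -` V" for V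
    using eq by auto
  then have "(\<lambda>z. \<psi> (k z)) holomorphic_on unit_disc \<inter> k -` V \<longleftrightarrow>
      (\<lambda>z. \<psi> (h z)) holomorphic_on unit_disc \<inter> h -` V" for \<psi> :: "'a \<Rightarrow> complex" and V
    using eq by (intro holomorphic_cong) auto
  moreover have "continuous_on unit_disc k \<longleftrightarrow> continuous_on unit_disc h"
    using eq by (intro continuous_on_cong) auto
  ultimately show ?thesis
    using h eq unfolding holomorphic_map_disc_iff by (simp add: Pi_iff)
qed

section \<open>Compact-open convergence\<close>

text \<open>The form in which compactness is used, both for subsets of the surface and for families of
  self-maps: an exhaustion of the disc by the balls \<open>ball 0 r\<close> induces an increasing open cover indexed
  by \<open>r < 1\<close>.\<close>

lemma compactin_increasing_cover:
  fixes V :: "real \<Rightarrow> 'b set"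
  assumes S: "compactin T S" and V: "\<And>r. r < 1 \<Longrightarrow> openin T (V r)"
    and mono: "\<And>r s. r \<le> s \<Longrightarrow> s < 1 \<Longrightarrow> V r \<subseteq> V s" and cover: "S \<subseteq> (\<Union>r\<in>{..<1}. V r)"
  obtains r where "0 < r" "r < 1" "S \<subseteq> V r"
proof -
  obtain \<G> where \<G>: "finite \<G>" "\<G> \<subseteq> V ` {..<1}" "S \<subseteq> \<Union>\<G>"
    using compactinD[OF S, of "V ` {..<1}"] V cover by auto
  then obtain R where R: "R \<subseteq> {..<1}" "finite R" "\<G> = V ` R"
    using finite_subset_image by metis
  let ?m = "Max (insert (1/2) R)"
  have "?m < 1"
    using R(1,2) by auto
  moreover have "1/2 \<le> ?m"
    using R(2) by (intro Max_ge) auto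
  moreover have "V r \<subseteq> V ?m" if "r \<in> R" for r
    using mono[of r ?m] \<open>?m < 1\<close> R(2) that by auto
  then have "S \<subseteq> V ?m"
    using \<G>(3) R(3) by blast
  ultimately show thesis
    using that[of ?m] by linarith
qed

lemma limitin_Hol_topologyI:
  assumes g: "g \<in> Hol X A" and \<phi>: "\<And>n. \<phi> n \<in> Hol X A"
    and lim: "\<And>K U. compact K \<Longrightarrow> K \<subseteq> X \<Longrightarrow> openin (top_of_set X) U \<Longrightarrow> g ` K \<subseteq> U \<Longrightarrow>
      \<forall>\<^sub>F n in sequentially. \<phi> n ` K \<subseteq> U"
  shows "limitin (Hol_topology X A) \<phi> g sequentially"
proof -
  have "\<forall>\<^sub>F n in sequentially. \<phi> n \<in> S" if "openin (Hol_topology X A) S" "g \<in> S" for S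
  proof -
    have "generate_topology_on {{f \<in> Hol X A. f ` K \<subseteq> U} |K U.
        compact K \<and> K \<subseteq> X \<and> openin (top_of_set X) U} S"
      using that(1) unfolding Hol_topology_def by (rule openin_topology_generated_by)
    then show ?thesis
      using that(2)
    proof induction
      case (Int a b)
      then show ?case by (simp add: eventually_conj)
    next
      case (UN K)
      then obtain k where "k \<in> K" "\<forall>\<^sub>F n in sequentially. \<phi> n \<in> k"
        by blast
      then show ?case by (auto elim: eventually_mono)
    next
      case (Basis s)
      then show ?case using lim \<phi> by auto
    qed simp
  qed
  then show ?thesis
    using g by (simp add: limitin_def)
qed

section \<open>Self-maps of the disc\<close>

text \<open>By compactness of the circle two powers of \<open>c ^ Suc N\<close> are close to each other; their quotient is
  a power of \<open>c\<close> with exponent beyond \<open>N\<close> that is close to \<open>1\<close>.\<close>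

lemma unit_power_recurrence:
  fixes c :: complex
  assumes c: "norm c = 1"
  obtains r :: "nat \<Rightarrow> nat" where "strict_mono r" "\<And>n. 1 \<le> r n" "(\<lambda>n. c ^ r n) \<longlonglongrightarrow> 1"
proof -
  have near: "\<exists>m>N. dist (c ^ m) 1 < e" if "e > 0" for e N
  proof -
    have "compact (sphere 0 1 :: complex set)" "\<forall>k. (c ^ Suc N) ^ k \<in> sphere 0 1"
      using c by (auto simp: norm_power norm_mult)
    then obtain l s where s: "strict_mono s" "((\<lambda>k. (c ^ Suc N) ^ k) \<circ> s) \<longlonglongrightarrow> l"
      using compact_def[of "sphere 0 1 :: complex set"] by metis
    then have "Cauchy ((\<lambda>k. (c ^ Suc N) ^ k) \<circ> s)"
      using LIMSEQ_imp_Cauchy by blast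
    then obtain M where "\<forall>i\<ge>M. \<forall>j\<ge>M. dist (((\<lambda>k. (c ^ Suc N) ^ k) \<circ> s) i) (((\<lambda>k. (c ^ Suc N) ^ k) \<circ> s) j) < e"
      using \<open>e > 0\<close> unfolding Cauchy_def by meson
    then have d: "dist ((c ^ Suc N) ^ s (Suc M)) ((c ^ Suc N) ^ s M) < e"
      by simp
    have lt: "s M < s (Suc M)"
      using s(1) by (simp add: strict_mono_def)
    let ?m = "Suc N * (s (Suc M) - s M)"
    have "(c ^ Suc N) ^ s (Suc M) = (c ^ Suc N) ^ s M * c ^ ?m"
      using lt by (metis le_add_diff_inverse less_imp_le power_add power_mult)
    then have "dist ((c ^ Suc N) ^ s (Suc M)) ((c ^ Suc N) ^ s M) = norm ((c ^ Suc N) ^ s M * (c ^ ?m - 1))"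
      by (simp add: dist_norm algebra_simps)
    also have "\<dots> = dist (c ^ ?m) 1"
      using c by (simp add: norm_mult norm_power dist_norm)
    finally have "dist (c ^ ?m) 1 < e"
      using d by simp
    moreover have "Suc N * 1 \<le> ?m"
      using lt by (intro mult_le_mono) auto
    then have "N < ?m"
      by simp
    ultimately show ?thesis
      by blast
  qed
  have "\<exists>r. \<forall>n. (1 \<le> r n \<and> dist (c ^ r n) 1 < inverse (Suc n)) \<and> r n < r (Suc n)"
  proof (rule dependent_nat_choice)
    show "\<exists>x. 1 \<le> x \<and> dist (c ^ x) 1 < inverse (Suc 0)"
      using near[of 1 0] by (auto simp: Suc_le_eq)
    show "\<exists>y. (1 \<le> y \<and> dist (c ^ y) 1 < inverse (Suc (Suc n))) \<and> x < y"
      if "1 \<le> x \<and> dist (c ^ x) 1 < inverse (Suc n)" for x n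
    proof -
      obtain m where "m > x" "dist (c ^ m) 1 < inverse (Suc (Suc n))"
        using near[of "inverse (Suc (Suc n))" x] by auto
      then show ?thesis
        using that by (intro exI[of _ m]) simp
    qed
  qed
  then obtain r :: "nat \<Rightarrow> nat" where r: "\<And>n. 1 \<le> r n" "\<And>n. dist (c ^ r n) 1 < inverse (Suc n)"
    "\<And>n. r n < r (Suc n)"
    by blast
  have "(\<lambda>n. dist (c ^ r n) 1) \<longlonglongrightarrow> 0"
    by (rule tendsto_sandwich[OF _ _ tendsto_const LIMSEQ_inverse_real_of_nat])
       (use r(2) less_imp_le in \<open>auto intro!: always_eventually\<close>)
  then show thesis
    using that[of r] r strict_mono_Suc_iff tendsto_dist_iff by blast
qed

lemma uniform_limit_rotations:
  fixes c :: "nat \<Rightarrow> complex"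
  assumes "c \<longlonglongrightarrow> d" "K \<subseteq> unit_disc"
  shows "uniform_limit K (\<lambda>n z. c n * z) (\<lambda>z. d * z) sequentially"
proof (rule uniform_limitI)
  fix e :: real assume "e > 0"
  then have "\<forall>\<^sub>F n in sequentially. dist (c n) d < e"
    using assms(1) tendstoD by blast
  then show "\<forall>\<^sub>F n in sequentially. \<forall>z\<in>K. dist (c n * z) (d * z) < e"
  proof eventually_elim
    case (elim n)
    have "dist (c n * z) (d * z) = dist (c n) d * norm z" for z
      by (metis dist_norm left_diff_distrib norm_mult)
    moreover have "dist (c n) d * norm z \<le> dist (c n) d" if "z \<in> K" for z
      using that assms(2) by (intro mult_left_le) auto
    ultimately show ?case
      using elim by (metis order_le_less_trans)
  qed
qed

lemma uniform_limit_at_moving_point: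
  assumes lim: "uniform_limit K f g sequentially" and g: "continuous_on K g"
    and z: "z \<longlonglongrightarrow> w" "w \<in> K" "\<forall>\<^sub>F n in sequentially. z n \<in> K"
  shows "(\<lambda>n. f n (z n)) \<longlonglongrightarrow> g w"
proof -
  have lim_g: "(\<lambda>n. g (z n)) \<longlonglongrightarrow> g w"
    using continuous_on_tendsto_compose[OF g z] .
  show ?thesis
  proof (rule tendstoI)
    fix e :: real assume "e > 0"
    then have "\<forall>\<^sub>F n in sequentially. \<forall>x\<in>K. dist (f n x) (g x) < e / 2"
      using uniform_limitD[OF lim, of "e / 2"] by simp
    moreover have "\<forall>\<^sub>F n in sequentially. dist (g (z n)) (g w) < e / 2"
      using tendstoD[OF lim_g, of "e / 2"] \<open>e > 0\<close> by simp
    ultimately show "\<forall>\<^sub>F n in sequentially. dist (f n (z n)) (g w) < e"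
      using z(3)
    proof eventually_elim
      case (elim n)
      have "dist (f n (z n)) (g w) \<le> dist (f n (z n)) (g (z n)) + dist (g (z n)) (g w)"
        by (rule dist_triangle)
      then show ?case
        using elim(1)[rule_format, OF elim(3)] elim(2) by linarith
    qed
  qed
qed

text \<open>The limit could leave the open disc only by being a constant of modulus \<open>1\<close>, by the maximum
  principle, and its value at \<open>0\<close> forbids this.\<close>

lemma limit_of_disc_maps_with_fixed_points_to_0:
  assumes self: "\<And>n z. norm z < 1 \<Longrightarrow> norm (F n z) < 1"
    and G: "G holomorphic_on unit_disc"
    and lim: "\<And>K. compact K \<Longrightarrow> K \<subseteq> unit_disc \<Longrightarrow> uniform_limit K F G sequentially"
    and b: "\<And>n. F n (b n) = b n" "b \<longlonglongrightarrow> 0"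
  shows "G 0 = 0" "norm z < 1 \<Longrightarrow> norm (G z) < 1"
proof -
  have cG: "continuous_on unit_disc G"
    using G holomorphic_on_imp_continuous_on by blast
  have "\<forall>\<^sub>F n in sequentially. b n \<in> cball 0 (1/2)"
    using tendstoD[OF b(2), of "1/2"] by (auto elim!: eventually_mono)
  then have "(\<lambda>n. F n (b n)) \<longlonglongrightarrow> G 0"
    by (intro uniform_limit_at_moving_point[OF lim[of "cball 0 (1/2)"] _ b(2)])
       (auto intro: continuous_on_subset[OF cG])
  then show G0: "G 0 = 0"
    using b LIMSEQ_unique by simp
  have le: "norm (G z) \<le> 1" if z: "norm z < 1" for z
  proof -
    have "(\<lambda>n. F n z) \<longlonglongrightarrow> G z"
      using tendsto_uniform_limitI[OF lim[of "{z}"], of z] z by simp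
    then show ?thesis
      by (rule tendsto_upperbound[OF tendsto_norm]) (use self[OF z] less_imp_le in \<open>auto intro!: always_eventually\<close>)
  qed
  show "norm (G z) < 1" if z: "norm z < 1"
  proof (rule ccontr)
    assume "\<not> norm (G z) < 1"
    then have eq: "norm (G z) = 1"
      using le[OF z] by simp
    have "G constant_on unit_disc"
      by (rule maximum_modulus_principle[OF G, of unit_disc z]) (use z eq le in auto)
    then have "G z = G 0"
      using z unfolding constant_on_def by (metis mem_ball_0 norm_zero zero_less_one)
    then show False
      using eq G0 by simp
  qed
qed

text \<open>If the estimate failed for every \<open>\<eta>\<close> and \<open>N\<close>, there would be \<open>F (n j)\<close> and points \<open>z j\<close> with
  \<open>norm (F (n j) (z j))\<close> above \<open>\<epsilon>\<close> and nearly at least \<open>norm (z j)\<close>. Passing to limits \<open>G\<close> and \<open>w\<close>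
  gives \<open>norm (G w) \<ge> norm w\<close> with \<open>G w \<noteq> 0\<close>, and the equality case of the Schwarz lemma makes \<open>G\<close> a
  rotation. The floor \<open>\<epsilon>\<close> is what keeps \<open>w\<close> away from \<open>0\<close>, where that equality carries no information.\<close>

lemma eventually_uniform_contraction:
  fixes F :: "nat \<Rightarrow> complex \<Rightarrow> complex"
  assumes hol: "\<And>n. F n holomorphic_on unit_disc"
    and self: "\<And>n z. norm z < 1 \<Longrightarrow> norm (F n z) < 1"
    and b: "\<And>n. F n (b n) = b n" "b \<longlonglongrightarrow> 0"
    and no_rotation: "\<And>s c. norm c = 1 \<Longrightarrow>
      \<not> (\<forall>K. compact K \<longrightarrow> K \<subseteq> unit_disc \<longrightarrow> uniform_limit K (\<lambda>j. F (s j)) (\<lambda>z. c * z) sequentially)"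
    and r: "r < 1" and \<epsilon>: "\<epsilon> > 0"
  obtains \<eta> N where "\<eta> > 0" "\<And>n z. n \<ge> N \<Longrightarrow> norm z \<le> r \<Longrightarrow> norm (F n z) \<le> max \<epsilon> (norm z - \<eta>)"
proof (rule ccontr)
  assume not: "\<not> thesis"
  have "\<exists>n z. n \<ge> j \<and> norm z \<le> r \<and> max \<epsilon> (norm z - inverse (Suc j)) < norm (F n z)" for j
    using not that[of "inverse (Suc j)" j] by (force simp: not_le)
  then obtain n z where n: "\<And>j. n j \<ge> j" and z: "\<And>j. norm (z j) \<le> r"
    and big: "\<And>j. max \<epsilon> (norm (z j) - inverse (Suc j)) < norm (F (n j) (z j))"
    by metis
  have "compact (cball 0 r :: complex set)" "\<forall>j. z j \<in> cball 0 r"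
    using z by auto
  then obtain w l where w: "w \<in> cball 0 r" and l: "strict_mono l" "(z \<circ> l) \<longlonglongrightarrow> w"
    using compact_def[of "cball 0 r :: complex set"] by metis
  obtain G k where G: "G holomorphic_on unit_disc" and k: "strict_mono k"
    and lim: "\<And>K. compact K \<Longrightarrow> K \<subseteq> unit_disc \<Longrightarrow>
      uniform_limit K ((\<lambda>j. F (n (l j))) \<circ> k) G sequentially"
  proof (rule Montel[of unit_disc "range F" "\<lambda>j. F (n (l j))"])
    show "\<exists>B. \<forall>h\<in>range F. \<forall>z\<in>K. norm (h z) \<le> B" if "K \<subseteq> unit_disc" for K
      using self that by (intro exI[of _ 1]) (auto intro!: less_imp_le)
  qed (use hol in auto)
  define s where "s = (\<lambda>j. n (l (k j)))"
  have lim_s: "uniform_limit K (\<lambda>j. F (s j)) G sequentially" if "compact K" "K \<subseteq> unit_disc" for K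
    using lim[OF that] by (simp add: s_def o_def)
  have "j \<le> s j" for j
    unfolding s_def using n seq_suble[OF l(1)] seq_suble[OF k] le_trans by metis
  then have "filterlim s at_top sequentially"
    by (intro filterlim_at_top_mono[OF filterlim_ident]) auto
  then have bs: "(\<lambda>j. b (s j)) \<longlonglongrightarrow> 0"
    using b(2) filterlim_compose by blast
  have G0: "G 0 = 0" and Gself: "\<And>z. norm z < 1 \<Longrightarrow> norm (G z) < 1"
    using limit_of_disc_maps_with_fixed_points_to_0[of "\<lambda>j. F (s j)" G "\<lambda>j. b (s j)"]
      self G lim_s b(1) bs by blast+
  have w1: "norm w < 1"
    using w r by simp
  have zs: "(\<lambda>j. z (l (k j))) \<longlonglongrightarrow> w"
    using LIMSEQ_subseq_LIMSEQ[OF l(2) k] by (simp add: o_def)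
  have "(\<lambda>j. F (s j) (z (l (k j)))) \<longlonglongrightarrow> G w"
    by (rule uniform_limit_at_moving_point[OF lim_s[of "cball 0 r"] _ zs w])
       (use r z G in \<open>auto intro!: holomorphic_on_imp_continuous_on elim: holomorphic_on_subset\<close>)
  then have Fz: "(\<lambda>j. norm (F (s j) (z (l (k j))))) \<longlonglongrightarrow> norm (G w)"
    by (rule tendsto_norm)
  have "\<epsilon> \<le> norm (G w)"
    by (rule tendsto_lowerbound[OF Fz])
       (use big in \<open>auto simp: s_def intro!: always_eventually less_imp_le\<close>)
  moreover have "norm w \<le> norm (G w)"
  proof (rule LIMSEQ_le[OF _ Fz])
    have "(\<lambda>j. inverse (real (Suc (l (k j))))) \<longlonglongrightarrow> 0"
      using LIMSEQ_subseq_LIMSEQ[OF LIMSEQ_inverse_real_of_nat strict_mono_o[OF l(1) k]]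
      by (simp add: o_def)
    then show "(\<lambda>j. norm (z (l (k j))) - inverse (real (Suc (l (k j))))) \<longlonglongrightarrow> norm w"
      using tendsto_diff[OF tendsto_norm[OF zs]] by fastforce
    show "\<exists>N. \<forall>j\<ge>N. norm (z (l (k j))) - inverse (real (Suc (l (k j)))) \<le> norm (F (s j) (z (l (k j))))"
      using big unfolding s_def by (meson less_imp_le max_less_iff_conj)
  qed
  moreover have "norm (G w) \<le> norm w"
    using Schwarz_Lemma(1)[OF G G0 Gself w1] .
  ultimately have "norm (G w) = norm w" "w \<noteq> 0"
    using \<epsilon> by auto
  then obtain c where c: "norm c = 1" "\<And>z. norm z < 1 \<Longrightarrow> G z = c * z"
    using Schwarz_Lemma(3)[OF G G0 Gself w1] w1 by blast
  have "uniform_limit K (\<lambda>j. F (s j)) (\<lambda>z. c * z) sequentially" if "compact K" "K \<subseteq> unit_disc" for K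
    using uniform_limit_cong'[of K "\<lambda>j. F (s j)" "\<lambda>j. F (s j)" G "\<lambda>z. c * z"] lim_s[OF that] c(2) that(2)
    by force
  then show False
    using no_rotation[OF c(1)] by blast
qed

section \<open>The covering disc of a surface\<close>

locale disc_uniformization =
  fixes X :: "'a::topological_space set" and A :: "'a complex_atlas" and p :: "complex \<Rightarrow> 'a"
  assumes surface: "riemann_surface X A"
    and covering: "covering_space unit_disc p X"
    and holomorphic_p: "holomorphic_map unit_disc unit_disc_atlas X A p"
begin

lemma Hausdorff: "Hausdorff_space (top_of_set X)"
  using surface by (simp add: riemann_surface_def)

lemma continuous_p: "continuous_on unit_disc p"
  using covering by (rule covering_space_imp_continuous)

lemma image_p: "p ` unit_disc = X"
  using covering by (rule covering_space_imp_surjective)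

lemma p_in: "norm z < 1 \<Longrightarrow> p z \<in> X"
  using image_p by auto

lemma lift_point:
  assumes "x \<in> X" obtains z where "norm z < 1" "p z = x"
  using assms image_p by auto

lemma chart_at:
  assumes "x \<in> X" obtains U \<phi> where "(U, \<phi>) \<in> A" "x \<in> U"
  using assms surface unfolding riemann_surface_def by force

lemma chartD:
  assumes "(U, \<phi>) \<in> A"
  shows "openin (top_of_set X) U" "inj_on \<phi> U"
proof -
  have "complex_chart X U \<phi>"
    using assms surface unfolding riemann_surface_def by auto
  then show "openin (top_of_set X) U" "inj_on \<phi> U"
    unfolding complex_chart_def homeomorphism_def by (auto intro: inj_on_inverseI)
qed

lemma open_vimage_disc:
  assumes "continuous_on unit_disc h" "h \<in> unit_disc \<rightarrow> X" "openin (top_of_set X) V"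
  shows "open (unit_disc \<inter> h -` V)"
  using continuous_openin_preimage[OF assms] openin_open_trans open_ball by blast

lemma open_map_p:
  assumes "open W" "W \<subseteq> unit_disc"
  shows "openin (top_of_set X) (p ` W)"
proof (subst openin_subopen, clarify)
  fix z assume z: "z \<in> W"
  then obtain S u q where S: "z \<in> S" "openin (top_of_set unit_disc) S"
    "p z \<in> u" "openin (top_of_set X) u" "homeomorphism S u p q"
    using covering_space_local_homeomorphism[OF covering, of z] assms(2) by blast
  have q: "continuous_on u q" "q \<in> u \<rightarrow> S" "\<And>w. w \<in> S \<Longrightarrow> q (p w) = w" "\<And>x. x \<in> u \<Longrightarrow> p (q x) = x"
    "p ` S = u"
    using S(5) by (auto simp: homeomorphism_def)
  have "openin (top_of_set u) (u \<inter> q -` W)"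
    using q(1) assms(1) by (rule continuous_openin_preimage_gen)
  then have "openin (top_of_set X) (u \<inter> q -` W)"
    using S(4) openin_trans by blast
  moreover have "p z \<in> u \<inter> q -` W"
    using S(1,3) q(3) z by auto
  moreover have "u \<inter> q -` W \<subseteq> p ` W"
    using q(4) by (metis IntD1 IntD2 imageI subsetI vimage_eq)
  ultimately show "\<exists>T. openin (top_of_set X) T \<and> p z \<in> T \<and> T \<subseteq> p ` W"
    by blast
qed

text \<open>In a chart \<open>\<phi>\<close> the covering is locally an injective holomorphic function, hence has a holomorphic
  inverse \<open>h\<close>. Holomorphy of lifts and of descended maps both rest on these local sections.\<close>

lemma local_section:
  assumes "norm z < 1" "(U, \<phi>) \<in> A" "p z \<in> U" "open N" "z \<in> N"
  obtains W h where "open W" "z \<in> W" "W \<subseteq> N" "W \<subseteq> unit_disc" "p ` W \<subseteq> U"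
    "open (\<phi> ` p ` W)" "h holomorphic_on \<phi> ` p ` W" "\<And>w. w \<in> W \<Longrightarrow> h (\<phi> (p w)) = w"
proof -
  obtain S u q where S: "z \<in> S" "openin (top_of_set unit_disc) S" "homeomorphism S u p q"
    using covering_space_local_homeomorphism[OF covering, of z] assms(1) by (metis mem_ball_0)
  define W where "W = S \<inter> (unit_disc \<inter> p -` U) \<inter> N"
  have "open S"
    using S(2) openin_open_trans by blast
  moreover have "open (unit_disc \<inter> p -` U)"
    using open_vimage_disc[OF continuous_p] p_in chartD(1)[OF assms(2)] by auto
  ultimately have W: "open W" "z \<in> W" "W \<subseteq> N" "W \<subseteq> unit_disc" "p ` W \<subseteq> U"
    using assms S(1) by (auto simp: W_def)
  have "inj_on p W"
    using S(3) unfolding W_def homeomorphism_def by (auto intro: inj_on_inverseI[of _ q])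
  moreover have "inj_on \<phi> (p ` W)"
    using chartD(2)[OF assms(2)] W(5) inj_on_subset by blast
  ultimately have inj: "inj_on (\<lambda>w. \<phi> (p w)) W"
    using comp_inj_on[of p W \<phi>] by (simp add: o_def)
  have "(\<lambda>z. \<phi> (p z)) holomorphic_on unit_disc \<inter> p -` U"
    using holomorphic_p assms(2) unfolding holomorphic_map_disc_iff by auto
  then have hol: "(\<lambda>w. \<phi> (p w)) holomorphic_on W"
    by (rule holomorphic_on_subset) (use W(4,5) in auto)
  obtain h where "h holomorphic_on (\<lambda>w. \<phi> (p w)) ` W" "\<And>w. w \<in> W \<Longrightarrow> h (\<phi> (p w)) = w"
    using holomorphic_has_inverse[OF hol W(1) inj] by metis
  moreover have "open ((\<lambda>w. \<phi> (p w)) ` W)"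
    using open_mapping_thm3[OF hol W(1) inj] .
  ultimately show thesis
    using that[OF W] by (simp add: image_image)
qed

text \<open>Near each point \<open>F\<close> is \<open>h\<close> followed by a chart and a holomorphic local section of \<open>p\<close>.\<close>

lemma holomorphic_lift:
  assumes F: "continuous_on unit_disc F" "F \<in> unit_disc \<rightarrow> unit_disc"
    and h: "holomorphic_map unit_disc unit_disc_atlas X A h"
    and lift: "\<And>z. norm z < 1 \<Longrightarrow> p (F z) = h z"
  shows "F holomorphic_on unit_disc"
proof (rule holomorphic_on_locally)
  fix z assume z: "z \<in> unit_disc"
  then have Fz: "norm (F z) < 1"
    using F(2) by auto
  then obtain U \<phi> where U: "(U, \<phi>) \<in> A" "p (F z) \<in> U"
    using chart_at p_in by blast
  obtain W s where "open W" "F z \<in> W" "W \<subseteq> UNIV" "W \<subseteq> unit_disc" "p ` W \<subseteq> U"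
    "open (\<phi> ` p ` W)" "s holomorphic_on \<phi> ` p ` W" "\<And>w. w \<in> W \<Longrightarrow> s (\<phi> (p w)) = w"
    by (rule local_section[OF Fz U open_UNIV UNIV_I]) (rule that)
  then have W: "open W" "F z \<in> W" "W \<subseteq> unit_disc" "p ` W \<subseteq> U"
    "s holomorphic_on \<phi> ` p ` W" "\<And>w. w \<in> W \<Longrightarrow> s (\<phi> (p w)) = w"
    by auto
  let ?N = "unit_disc \<inter> F -` W"
  have N: "open ?N"
    using F(1) W(1) continuous_open_preimage open_ball by blast
  have hF: "h w = p (F w)" if "w \<in> ?N" for w
    using that lift[of w] by simp
  have "(\<lambda>w. \<phi> (h w)) holomorphic_on unit_disc \<inter> h -` U"
    using h U(1) unfolding holomorphic_map_disc_iff by auto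
  moreover have "?N \<subseteq> unit_disc \<inter> h -` U"
    using W(4) hF by auto
  ultimately have "(\<lambda>w. \<phi> (h w)) holomorphic_on ?N"
    using holomorphic_on_subset by blast
  moreover have "(\<lambda>w. \<phi> (h w)) ` ?N \<subseteq> \<phi> ` p ` W"
    using hF by auto
  ultimately have "(\<lambda>w. s (\<phi> (h w))) holomorphic_on ?N"
    using holomorphic_on_compose_gen[OF _ W(5)] by (simp add: o_def)
  then have "F holomorphic_on ?N"
    by (rule holomorphic_transform) (use W(6) hF in auto)
  then show "\<exists>N. open N \<and> z \<in> N \<and> F holomorphic_on N"
    using N z W(2) by blast
qed

text \<open>Since \<open>p\<close> is an open map with holomorphic local sections, a self-map of \<open>X\<close> may be tested for
  holomorphy after composing it with \<open>p\<close>.\<close>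

lemma HolI_lift:
  assumes g: "g \<in> extensional X"
    and h: "holomorphic_map unit_disc unit_disc_atlas X A (\<lambda>z. g (p z))"
  shows "g \<in> Hol X A"
proof -
  have gX: "g \<in> X \<rightarrow> X" and cont: "continuous_on unit_disc (\<lambda>z. g (p z))"
    and gp: "(\<lambda>z. g (p z)) \<in> unit_disc \<rightarrow> X"
    using h image_p unfolding holomorphic_map_disc_iff by auto
  have "continuous_on X g"
  proof (rule continuous_on_open_gen[THEN iffD2, OF gX], intro allI impI)
    fix V assume V: "openin (top_of_set X) V"
    have "X \<inter> g -` V = p ` (unit_disc \<inter> (\<lambda>z. g (p z)) -` V)"
      using image_p by auto
    then show "openin (top_of_set X) (X \<inter> g -` V)"
      using open_map_p open_vimage_disc[OF cont gp V] by simp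
  qed
  moreover have "(\<psi> \<circ> g \<circ> inv_into U \<phi>) holomorphic_on \<phi> ` (U \<inter> g -` V)"
    if UV: "(U, \<phi>) \<in> A" "(V, \<psi>) \<in> A" for U \<phi> V \<psi>
  proof (rule holomorphic_on_locally)
    fix y assume "y \<in> \<phi> ` (U \<inter> g -` V)"
    then obtain x where x: "x \<in> U" "g x \<in> V" "y = \<phi> x"
      by blast
    then obtain z where z: "norm z < 1" "p z = x"
      using lift_point chartD(1)[OF UV(1)] openin_imp_subset by blast
    let ?N = "unit_disc \<inter> (\<lambda>z. g (p z)) -` V"
    have "open ?N"
      using open_vimage_disc[OF cont gp] chartD(1)[OF UV(2)] .
    then obtain W s where W: "open W" "z \<in> W" "W \<subseteq> ?N" "W \<subseteq> unit_disc" "p ` W \<subseteq> U"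
      "open (\<phi> ` p ` W)" "s holomorphic_on \<phi> ` p ` W" "\<And>w. w \<in> W \<Longrightarrow> s (\<phi> (p w)) = w"
      using local_section[OF z(1) UV(1), of ?N] x z by auto
    have "(\<lambda>z. \<psi> (g (p z))) holomorphic_on W"
      using h UV(2) W(3) holomorphic_on_subset unfolding holomorphic_map_disc_iff by blast
    moreover have "s ` \<phi> ` p ` W \<subseteq> W"
      using W(8) by auto
    ultimately have "(\<lambda>y. \<psi> (g (p (s y)))) holomorphic_on \<phi> ` p ` W"
      using holomorphic_on_compose_gen[OF W(7)] by (simp add: o_def)
    then have "(\<psi> \<circ> g \<circ> inv_into U \<phi>) holomorphic_on \<phi> ` p ` W"
    proof (rule holomorphic_transform)
      fix y assume "y \<in> \<phi> ` p ` W"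
      then obtain w where w: "w \<in> W" "y = \<phi> (p w)"
        by blast
      then have "inv_into U \<phi> y = p w"
        using chartD(2)[OF UV(1)] W(5) by (simp add: image_subset_iff)
      then show "\<psi> (g (p (s y))) = (\<psi> \<circ> g \<circ> inv_into U \<phi>) y"
        using W(8) w by simp
    qed
    then show "\<exists>N. open N \<and> y \<in> N \<and> (\<psi> \<circ> g \<circ> inv_into U \<phi>) holomorphic_on N"
      using W(2,6) z(2) x(3) by blast
  qed
  ultimately show ?thesis
    using g gX unfolding Hol_def holomorphic_map_def by blast
qed

lemma holomorphic_map_disc_compose:
  assumes g: "g \<in> Hol X A" and h: "holomorphic_map unit_disc unit_disc_atlas X A h"
  shows "holomorphic_map unit_disc unit_disc_atlas X A (\<lambda>z. g (h z))"
proof -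
  have gX: "g \<in> X \<rightarrow> X" and cg: "continuous_on X g"
    using g unfolding Hol_def holomorphic_map_def by auto
  have hX: "h \<in> unit_disc \<rightarrow> X" and ch: "continuous_on unit_disc h"
    using h unfolding holomorphic_map_disc_iff by auto
  have cont: "continuous_on unit_disc (\<lambda>z. g (h z))"
    using continuous_on_compose2[OF cg ch] hX by blast
  have ghX: "(\<lambda>z. g (h z)) \<in> unit_disc \<rightarrow> X"
    using gX hX by auto
  have "(\<lambda>z. \<psi> (g (h z))) holomorphic_on unit_disc \<inter> (\<lambda>z. g (h z)) -` V" if V: "(V, \<psi>) \<in> A" for V \<psi>
  proof (rule holomorphic_on_locally)
    fix z assume z: "z \<in> unit_disc \<inter> (\<lambda>z. g (h z)) -` V"
    then obtain U \<phi> where U: "(U, \<phi>) \<in> A" "h z \<in> U"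
      using chart_at[of "h z"] hX by blast
    let ?N = "(unit_disc \<inter> h -` U) \<inter> (unit_disc \<inter> (\<lambda>z. g (h z)) -` V)"
    have N: "open ?N"
      using open_vimage_disc[OF ch hX chartD(1)[OF U(1)]]
        open_vimage_disc[OF cont ghX chartD(1)[OF V]] by blast
    have "(\<lambda>z. \<phi> (h z)) holomorphic_on unit_disc \<inter> h -` U"
      using h U(1) unfolding holomorphic_map_disc_iff by auto
    then have 1: "(\<lambda>z. \<phi> (h z)) holomorphic_on ?N"
      by (rule holomorphic_on_subset) blast
    have 2: "(\<psi> \<circ> g \<circ> inv_into U \<phi>) holomorphic_on \<phi> ` (U \<inter> g -` V)"
      using g U(1) V unfolding Hol_def holomorphic_map_def by blast
    have "((\<psi> \<circ> g \<circ> inv_into U \<phi>) \<circ> (\<lambda>z. \<phi> (h z))) holomorphic_on ?N"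
      by (rule holomorphic_on_compose_gen[OF 1 2]) auto
    then have "(\<lambda>z. \<psi> (g (h z))) holomorphic_on ?N"
      by (rule holomorphic_transform) (use chartD(2)[OF U(1)] in auto)
    then show "\<exists>N. open N \<and> z \<in> N \<and> (\<lambda>z. \<psi> (g (h z))) holomorphic_on N"
      using N z U(2) by blast
  qed
  then show ?thesis
    unfolding holomorphic_map_disc_iff using ghX cont by blast
qed

lemma holomorphic_map_disc_reparametrize:
  assumes G: "G holomorphic_on unit_disc" "G \<in> unit_disc \<rightarrow> unit_disc"
  shows "holomorphic_map unit_disc unit_disc_atlas X A (\<lambda>z. p (G z))"
proof -
  have cG: "continuous_on unit_disc G"
    using G(1) holomorphic_on_imp_continuous_on by blast
  have "(\<lambda>z. \<psi> (p (G z))) holomorphic_on unit_disc \<inter> (\<lambda>z. p (G z)) -` V" if V: "(V, \<psi>) \<in> A" for V \<psi>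
  proof -
    have 1: "(\<lambda>z. \<psi> (p z)) holomorphic_on unit_disc \<inter> p -` V"
      using holomorphic_p V unfolding holomorphic_map_disc_iff by auto
    have 2: "G holomorphic_on unit_disc \<inter> (\<lambda>z. p (G z)) -` V"
      using G(1) by (rule holomorphic_on_subset) blast
    show ?thesis
      using holomorphic_on_compose_gen[OF 2 1] G(2) by (auto simp: o_def)
  qed
  moreover have "continuous_on unit_disc (\<lambda>z. p (G z))"
    using continuous_on_compose2[OF continuous_p cG] G(2) by blast
  ultimately show ?thesis
    unfolding holomorphic_map_disc_iff using G(2) image_p by blast
qed

lemma compose_in_Hol:
  assumes "f \<in> Hol X A" "g \<in> Hol X A"
  shows "compose X f g \<in> Hol X A"
proof (rule HolI_lift)
  have "holomorphic_map unit_disc unit_disc_atlas X A (\<lambda>z. f (g (p z)))"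
    using assms holomorphic_map_disc_compose holomorphic_p by blast
  then show "holomorphic_map unit_disc unit_disc_atlas X A (\<lambda>z. compose X f g (p z))"
    by (rule holomorphic_map_disc_cong) (simp add: p_in compose_def)
qed (simp add: compose_def)

section \<open>Limits of lifted sequences\<close>

lemma compact_covered_by_small_disc:
  assumes "compact K" "K \<subseteq> X"
  obtains r where "0 < r" "r < 1" "K \<subseteq> p ` ball 0 r"
proof (rule compactin_increasing_cover[of "top_of_set X" K "\<lambda>r. p ` ball 0 r"])
  show "compactin (top_of_set X) K"
    using assms by (simp add: compactin_subtopology)
  show "openin (top_of_set X) (p ` ball 0 r)" if "r < 1" for r
    using that by (intro open_map_p) auto
  show "K \<subseteq> (\<Union>r\<in>{..<1}. p ` ball 0 r)"
  proof
    fix x assume "x \<in> K"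
    then obtain z where "norm z < 1" "p z = x"
      using assms(2) lift_point by blast
    then show "x \<in> (\<Union>r\<in>{..<1}. p ` ball 0 r)"
      using dense[of "norm z" 1] by force
  qed
qed (auto intro: that)

text \<open>The limit \<open>\<Gamma>\<close> descends because \<open>p (\<Gamma> z)\<close> is the limit of \<open>\<phi> n (p z)\<close>, which depends on \<open>p z\<close>
  alone, and limits in \<open>X\<close> are unique. Convergence below is uniform on compact sets because a compact
  subset of \<open>X\<close> is the image of a compact subset of the disc.\<close>

lemma lifts_converge:
  assumes \<phi>: "\<And>n. \<phi> n \<in> Hol X A"
    and \<Phi>: "\<And>n z. norm z < 1 \<Longrightarrow> norm (\<Phi> n z) < 1" "\<And>n z. norm z < 1 \<Longrightarrow> p (\<Phi> n z) = \<phi> n (p z)"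
    and lim: "\<And>K. compact K \<Longrightarrow> K \<subseteq> unit_disc \<Longrightarrow> uniform_limit K \<Phi> \<Gamma> sequentially"
    and \<Gamma>: "\<Gamma> holomorphic_on unit_disc" "\<Gamma> \<in> unit_disc \<rightarrow> unit_disc"
  obtains g where "g \<in> Hol X A" "\<And>z. norm z < 1 \<Longrightarrow> g (p z) = p (\<Gamma> z)"
    "limitin (Hol_topology X A) \<phi> g sequentially"
proof -
  have c\<Gamma>: "continuous_on unit_disc \<Gamma>"
    using \<Gamma>(1) holomorphic_on_imp_continuous_on by blast
  have near: "\<forall>\<^sub>F n in sequentially. \<Phi> n ` K \<subseteq> V"
    if K: "compact K" "K \<subseteq> unit_disc" and V: "open V" "\<Gamma> ` K \<subseteq> V" for K V
  proof -
    have "compact (\<Gamma> ` K)"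
      using K c\<Gamma> compact_continuous_image continuous_on_subset by blast
    then obtain e where e: "e > 0" "(\<Union>x\<in>\<Gamma> ` K. ball x e) \<subseteq> V"
      using V compact_subset_open_imp_ball_epsilon_subset by blast
    have "\<forall>\<^sub>F n in sequentially. \<forall>z\<in>K. dist (\<Phi> n z) (\<Gamma> z) < e"
      using lim[OF K] e(1) uniform_limitD by blast
    then show ?thesis
      by eventually_elim (use e(2) in \<open>force simp: dist_commute\<close>)
  qed
  have pV: "open (unit_disc \<inter> p -` V)" if "openin (top_of_set X) V" for V
    using open_vimage_disc[OF continuous_p] p_in that by auto
  have pointwise: "limitin (top_of_set X) (\<lambda>n. \<phi> n (p z)) (p (\<Gamma> z)) sequentially"
    if z: "norm z < 1" for z
    unfolding limitin_def
  proof (intro conjI allI impI)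
    have "norm (\<Gamma> z) < 1"
      using z \<Gamma>(2) by auto
    then show "p (\<Gamma> z) \<in> topspace (top_of_set X)"
      using p_in by simp
    fix V assume V: "openin (top_of_set X) V \<and> p (\<Gamma> z) \<in> V"
    have "\<forall>\<^sub>F n in sequentially. \<Phi> n ` {z} \<subseteq> unit_disc \<inter> p -` V"
      using near[of "{z}" "unit_disc \<inter> p -` V"] pV[of V] V z \<open>norm (\<Gamma> z) < 1\<close> by simp
    then show "\<forall>\<^sub>F n in sequentially. \<phi> n (p z) \<in> V"
      by eventually_elim (use \<Phi>(2)[OF z] in simp)
  qed
  have wd: "p (\<Gamma> z) = p (\<Gamma> w)" if "norm z < 1" "norm w < 1" "p z = p w" for z w
    using limitin_Hausdorff_unique[OF pointwise[OF that(1)], of "p (\<Gamma> w)"] pointwise[OF that(2)]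
      that(3) Hausdorff by simp
  \<comment> \<open>By \<open>wd\<close> the choice of the preimage is immaterial.\<close>
  define g where "g = (\<lambda>x\<in>X. p (\<Gamma> (SOME z. norm z < 1 \<and> p z = x)))"
  have gp: "g (p z) = p (\<Gamma> z)" if z: "norm z < 1" for z
  proof -
    let ?w = "SOME w. norm w < 1 \<and> p w = p z"
    have "norm ?w < 1 \<and> p ?w = p z"
      by (rule someI[of "\<lambda>w. norm w < 1 \<and> p w = p z" z]) (use z in simp)
    then have "p (\<Gamma> ?w) = p (\<Gamma> z)"
      using wd z by blast
    then show ?thesis
      using p_in[OF z] by (simp add: g_def)
  qed
  have g: "g \<in> Hol X A"
  proof (rule HolI_lift)
    show "holomorphic_map unit_disc unit_disc_atlas X A (\<lambda>z. g (p z))"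
      using holomorphic_map_disc_reparametrize[OF \<Gamma>]
      by (rule holomorphic_map_disc_cong) (use gp in simp)
  qed (simp add: g_def)
  moreover have "limitin (Hol_topology X A) \<phi> g sequentially"
  proof (rule limitin_Hol_topologyI[OF g \<phi>])
    fix K U assume K: "compact K" "K \<subseteq> X" and U: "openin (top_of_set X) U" "g ` K \<subseteq> U"
    obtain r where r: "r < 1" "K \<subseteq> p ` ball 0 r"
      using compact_covered_by_small_disc[OF K] by metis
    have "compactin (top_of_set X) K"
      using K by (simp add: compactin_subtopology)
    then have cl: "closedin (top_of_set X) K"
      using compactin_imp_closedin Hausdorff by blast
    have "continuous_on (cball 0 r) p" "p \<in> cball 0 r \<rightarrow> X"
      using r(1) p_in by (auto intro!: continuous_on_subset[OF continuous_p])
    then have "closedin (top_of_set (cball 0 r)) (cball 0 r \<inter> p -` K)"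
      using cl by (rule continuous_closedin_preimage_gen)
    then have "compact (cball 0 r \<inter> p -` K)"
      by (rule closedin_compact[OF compact_cball])
    moreover have "cball 0 r \<inter> p -` K \<subseteq> unit_disc"
      using r(1) by auto
    moreover have "\<Gamma> ` (cball 0 r \<inter> p -` K) \<subseteq> unit_disc \<inter> p -` U"
    proof (rule image_subsetI)
      fix z assume "z \<in> cball 0 r \<inter> p -` K"
      then have z: "norm z < 1" "p z \<in> K"
        using r(1) by auto
      then have "g (p z) \<in> U"
        using U(2) by blast
      then show "\<Gamma> z \<in> unit_disc \<inter> p -` U"
        using z(1) gp[of z] \<Gamma>(2) by auto
    qed
    ultimately have "\<forall>\<^sub>F n in sequentially. \<Phi> n ` (cball 0 r \<inter> p -` K) \<subseteq> unit_disc \<inter> p -` U"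
      using near pV[OF U(1)] by blast
    then show "\<forall>\<^sub>F n in sequentially. \<phi> n ` K \<subseteq> U"
    proof eventually_elim
      case (elim n)
      show ?case
      proof clarify
        fix x assume "x \<in> K"
        then obtain z where z: "norm z < r" "x = p z"
          using r(2) by auto
        then have "z \<in> cball 0 r \<inter> p -` K"
          using \<open>x \<in> K\<close> by simp
        then have "\<Phi> n z \<in> unit_disc \<inter> p -` U"
          using elim by blast
        then show "\<phi> n x \<in> U"
          using \<Phi>(2)[of z n] z r(1) by auto
      qed
    qed
  qed
  ultimately show thesis
    using that gp by blast
qed

section \<open>Rotations as lifts\<close>

lemma iterate_lift:
  assumes g: "\<And>z. norm z < 1 \<Longrightarrow> g (p z) = p (c * z)" and c: "norm c = 1" and z: "norm z < 1"
  shows "iterate X g n (p z) = p (c ^ n * z)"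
proof -
  have "(g ^^ n) (p z) = p (c ^ n * z)"
  proof (induction n)
    case (Suc n)
    have "norm (c ^ n * z) < 1"
      using c z by (simp add: norm_mult norm_power)
    then show ?case
      using Suc g by (simp add: mult.assoc)
  qed simp
  then show ?thesis
    using p_in[OF z] by (simp add: iterate_def)
qed

text \<open>Choose exponents \<open>r n\<close> with \<open>c ^ r n\<close> tending to \<open>1\<close>. The iterates of \<open>g\<close> of order \<open>r n\<close> are covered
  by rotations tending to the identity, so they tend to the identity. Those of order \<open>r n - 1\<close> are
  covered by rotations tending to the rotation by \<open>inverse c\<close>, so they have a limit, which is an
  inverse of \<open>g\<close>.\<close>

lemma rotation_lift_imp_periodic_or_pseudoperiodic:
  assumes g: "g \<in> Hol X A" and gp: "\<And>z. norm z < 1 \<Longrightarrow> g (p z) = p (c * z)" and c: "norm c = 1"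
  shows "periodic_automorphism X A g \<or> pseudoperiodic_automorphism X A g"
proof -
  obtain r where r: "strict_mono r" "\<And>n. 1 \<le> r n" "(\<lambda>n. c ^ r n) \<longlonglongrightarrow> 1"
    by (rule unit_power_recurrence[OF c]) (rule that)
  have rot: "(\<lambda>z. d * z) holomorphic_on unit_disc" "(\<lambda>z. d * z) \<in> unit_disc \<rightarrow> unit_disc"
    if "norm d = 1" for d :: complex
    using that by (auto intro!: holomorphic_intros simp: norm_mult)
  have iterate_Hol: "iterate X g n \<in> Hol X A" for n
  proof (rule HolI_lift)
    show "holomorphic_map unit_disc unit_disc_atlas X A (\<lambda>z. iterate X g n (p z))"
      using holomorphic_map_disc_reparametrize[OF rot[of "c ^ n"]]
      by (rule holomorphic_map_disc_cong) (use c iterate_lift[OF gp c] in \<open>auto simp: norm_power\<close>)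
  qed (simp add: iterate_def)
  have limit: "\<exists>h. h \<in> Hol X A \<and> (\<forall>z. norm z < 1 \<longrightarrow> h (p z) = p (d * z)) \<and>
      limitin (Hol_topology X A) (\<lambda>n. iterate X g (m n)) h sequentially"
    if d: "norm d = 1" "(\<lambda>n. c ^ m n) \<longlonglongrightarrow> d" for d m
  proof -
    obtain h where "h \<in> Hol X A" "\<And>z. norm z < 1 \<Longrightarrow> h (p z) = p (d * z)"
      "limitin (Hol_topology X A) (\<lambda>n. iterate X g (m n)) h sequentially"
    proof (rule lifts_converge[of "\<lambda>n. iterate X g (m n)" "\<lambda>n z. c ^ m n * z" "\<lambda>z. d * z"])
      show "norm (c ^ m n * z) < 1" "p (c ^ m n * z) = iterate X g (m n) (p z)" if "norm z < 1" for n z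
        using that c iterate_lift[OF gp c that] by (auto simp: norm_mult norm_power)
    qed (use iterate_Hol rot[OF d(1)] uniform_limit_rotations[OF d(2)] in auto)
    then show ?thesis by blast
  qed
  have id: "h = identity_map X" if "h \<in> extensional X" "\<And>z. norm z < 1 \<Longrightarrow> h (p z) = p z" for h
  proof (rule extensionalityI)
    show "h x = identity_map X x" if "x \<in> X" for x
      using lift_point[OF \<open>x \<in> X\<close>] \<open>\<And>z. norm z < 1 \<Longrightarrow> h (p z) = p z\<close> \<open>x \<in> X\<close>
      unfolding identity_map_def by (metis restrict_apply')
  qed (use that in \<open>auto simp: identity_map_def\<close>)
  obtain h where h: "h \<in> Hol X A" "\<And>z. norm z < 1 \<Longrightarrow> h (p z) = p (1 * z)"
    "limitin (Hol_topology X A) (\<lambda>n. iterate X g (r n)) h sequentially"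
    using limit[of 1 r] r(3) by auto
  have "h = identity_map X"
    using id[of h] h(1,2) unfolding Hol_def by simp
  have "c \<noteq> 0"
    using c by auto
  \<comment> \<open>The exponents \<open>r n\<close> are positive, so the subtraction does not truncate.\<close>
  have "c ^ (r n - 1) = c ^ r n * inverse c" for n
    using r(2)[of n] \<open>c \<noteq> 0\<close> by (simp add: power_diff field_simps)
  then have "(\<lambda>n. c ^ (r n - 1)) \<longlonglongrightarrow> inverse c"
    using tendsto_mult[OF r(3) tendsto_const[of "inverse c"]] by simp
  then obtain k where k: "k \<in> Hol X A" "\<And>z. norm z < 1 \<Longrightarrow> k (p z) = p (inverse c * z)"
    using limit[of "inverse c" "\<lambda>n. r n - 1"] c by (auto simp: norm_inverse)
  have "compose X k g (p z) = p z" "compose X g k (p z) = p z" if z: "norm z < 1" for z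
    using z c \<open>c \<noteq> 0\<close> p_in[OF z] gp k(2) by (auto simp: compose_def norm_mult norm_inverse simp flip: mult.assoc)
  then have "compose X k g = identity_map X" "compose X g k = identity_map X"
    using id by (auto simp: compose_extensional)
  then have "holomorphic_automorphism X A g"
    unfolding holomorphic_automorphism_def using g k(1) by blast
  then show ?thesis
    unfolding pseudoperiodic_automorphism_def using h(3) r(1) \<open>h = identity_map X\<close> by blast
qed

section \<open>Lifting the iterated function system\<close>

lemma self_map_lift_fixing_point:
  assumes f: "f \<in> Hol X A" and z: "norm z < 1" and fix_z: "f (p z) = p z"
  shows "\<exists>F. F holomorphic_on unit_disc \<and> F z = z \<and>
    (\<forall>w. norm w < 1 \<longrightarrow> norm (F w) < 1 \<and> p (F w) = f (p w))"
proof -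
  have h: "holomorphic_map unit_disc unit_disc_atlas X A (\<lambda>w. f (p w))"
    using holomorphic_map_disc_compose[OF f holomorphic_p] .
  then have "continuous_on unit_disc (\<lambda>w. f (p w))" "(\<lambda>w. f (p w)) \<in> unit_disc \<rightarrow> X"
    unfolding holomorphic_map_disc_iff by auto
  then obtain F where F: "continuous_on unit_disc F" "F \<in> unit_disc \<rightarrow> unit_disc" "F z = z"
    "\<And>y. y \<in> unit_disc \<Longrightarrow> p (F y) = f (p y)"
    using disc_lift_exists[OF covering, of "\<lambda>w. f (p w)" z z] z fix_z
    by (metis mem_ball_0)
  have "F holomorphic_on unit_disc"
    using holomorphic_lift[OF F(1,2) h] F(4) by simp
  then show ?thesis
    using F by (intro exI[of _ F]) auto
qed

text \<open>Terms near the limit are lifted by a local inverse of \<open>p\<close>, the finitely many others arbitrarily.\<close>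

lemma convergent_sequence_lift:
  assumes \<alpha>: "\<And>n. \<alpha> n \<in> X" and lim: "limitin (top_of_set X) \<alpha> (p z) sequentially" and z: "norm z < 1"
  obtains b where "\<And>n. norm (b n) < 1" "\<And>n. p (b n) = \<alpha> n" "b \<longlonglongrightarrow> z"
proof -
  obtain S u q where S: "z \<in> S" "openin (top_of_set unit_disc) S"
    "p z \<in> u" "openin (top_of_set X) u" "homeomorphism S u p q"
    using covering_space_local_homeomorphism[OF covering, of z] z by (metis mem_ball_0)
  have q: "q \<in> u \<rightarrow> S" "\<And>w. w \<in> S \<Longrightarrow> q (p w) = w" "\<And>x. x \<in> u \<Longrightarrow> p (q x) = x"
    using S(5) by (auto simp: homeomorphism_def)
  have "S \<subseteq> unit_disc" "open S"
    using S(2) openin_imp_subset openin_open_trans by blast+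
  define b where "b n = (if \<alpha> n \<in> u then q (\<alpha> n) else SOME w. norm w < 1 \<and> p w = \<alpha> n)" for n
  have b: "norm (b n) < 1 \<and> p (b n) = \<alpha> n" for n
  proof (cases "\<alpha> n \<in> u")
    case True
    then show ?thesis
      using q \<open>S \<subseteq> unit_disc\<close> by (auto simp: b_def)
  next
    case False
    have "\<exists>w. norm w < 1 \<and> p w = \<alpha> n"
      using \<alpha> lift_point by metis
    from someI_ex[OF this] show ?thesis
      using False by (simp add: b_def)
  qed
  have "b \<longlonglongrightarrow> z"
  proof (rule topological_tendstoI)
    fix W assume W: "open W" "z \<in> W"
    have "openin (top_of_set X) (p ` (W \<inter> S))"
      using W(1) \<open>open S\<close> \<open>S \<subseteq> unit_disc\<close> by (intro open_map_p) auto
    moreover have "p z \<in> p ` (W \<inter> S)"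
      using W(2) S(1) by blast
    ultimately have "\<forall>\<^sub>F n in sequentially. \<alpha> n \<in> p ` (W \<inter> S)"
      using lim unfolding limitin_def by blast
    then show "\<forall>\<^sub>F n in sequentially. b n \<in> W"
    proof eventually_elim
      case (elim n)
      then obtain w where w: "w \<in> W" "w \<in> S" "\<alpha> n = p w"
        by blast
      then have "\<alpha> n \<in> u"
        using S(5) by (auto simp: homeomorphism_def)
      then show ?case
        using w q(2) by (simp add: b_def)
    qed
  qed
  then show thesis
    using that b by blast
qed

lemma left_ifs_in_Hol:
  assumes "\<And>n. n \<ge> 1 \<Longrightarrow> f n \<in> Hol X A"
  shows "left_ifs X f n \<in> Hol X A"
proof (induction n)
  case 0
  have "holomorphic_map unit_disc unit_disc_atlas X A (\<lambda>z. identity_map X (p z))"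
    using holomorphic_p by (rule holomorphic_map_disc_cong) (simp add: identity_map_def p_in)
  moreover have "identity_map X \<in> extensional X"
    by (simp add: identity_map_def)
  ultimately show ?case
    using HolI_lift by simp
qed (use assms compose_in_Hol in simp)

text \<open>Each map sends \<open>K\<close> to a compact set, which lies under some smaller disc. The maps for which the disc
  of radius \<open>r\<close> suffices form an open family that grows with \<open>r\<close>, so one radius serves for the whole
  compact closure.\<close>

lemma relatively_compact_images_in_small_disc:
  assumes S: "compactin (Hol_topology X A) (Hol_topology X A closure_of S)" "S \<subseteq> Hol X A"
    and K: "compact K" "K \<subseteq> X"
  obtains r where "0 < r" "r < 1" "\<And>g. g \<in> S \<Longrightarrow> g ` K \<subseteq> p ` ball 0 r"
proof (rule compactin_increasing_cover[OF S(1), of "\<lambda>r. {g \<in> Hol X A. g ` K \<subseteq> p ` ball 0 r}"])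
  show "openin (Hol_topology X A) {g \<in> Hol X A. g ` K \<subseteq> p ` ball 0 r}" if "r < 1" for r
  proof -
    have "openin (top_of_set X) (p ` ball 0 r)"
      using that by (intro open_map_p) auto
    then show ?thesis
      unfolding Hol_topology_def using K by (intro topology_generated_by_Basis) blast
  qed
  show "{g \<in> Hol X A. g ` K \<subseteq> p ` ball 0 r} \<subseteq> {g \<in> Hol X A. g ` K \<subseteq> p ` ball 0 s}" if "r \<le> s" for r s
    using subset_ball[OF that, of 0] by blast
  show "Hol_topology X A closure_of S \<subseteq> (\<Union>r\<in>{..<1}. {g \<in> Hol X A. g ` K \<subseteq> p ` ball 0 r})"
  proof
    fix g assume "g \<in> Hol_topology X A closure_of S"
    then have g: "g \<in> Hol X A"
      using closure_of_subset_topspace by force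
    then have "compact (g ` K)" "g ` K \<subseteq> X"
      using K continuous_on_subset[of X g K] compact_continuous_image[of K g]
      unfolding Hol_def holomorphic_map_def by auto
    then obtain r where "r < 1" "g ` K \<subseteq> p ` ball 0 r"
      using compact_covered_by_small_disc by metis
    then show "g \<in> (\<Union>r\<in>{..<1}. {g \<in> Hol X A. g ` K \<subseteq> p ` ball 0 r})"
      using g by auto
  qed
  show thesis if "0 < r" "r < 1" "Hol_topology X A closure_of S \<subseteq> {g \<in> Hol X A. g ` K \<subseteq> p ` ball 0 r}" for r
    using that(3) closure_of_subset[of S "Hol_topology X A"] S(2)
    by (intro \<open>\<And>r. 0 < r \<Longrightarrow> r < 1 \<Longrightarrow> (\<And>g. g \<in> S \<Longrightarrow> g ` K \<subseteq> p ` ball 0 r) \<Longrightarrow> thesis\<close>[OF that(1,2)]) auto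
qed

text \<open>A limiting rotation would cover a limit of the maps \<open>f n\<close>, hence an excluded automorphism.\<close>

lemma no_rotation_is_limit_of_lifts:
  assumes f: "\<And>n. f n \<in> \<F>" and \<F>: "\<F> \<subseteq> Hol X A"
    and aperiodic: "\<forall>g \<in> Hol_topology X A closure_of \<F>.
       \<not> periodic_automorphism X A g \<and> \<not> pseudoperiodic_automorphism X A g"
    and F: "\<And>n z. norm z < 1 \<Longrightarrow> norm (F n z) < 1" "\<And>n z. norm z < 1 \<Longrightarrow> p (F n z) = f n (p z)"
    and c: "norm c = 1"
  shows "\<not> (\<forall>K. compact K \<longrightarrow> K \<subseteq> unit_disc \<longrightarrow> uniform_limit K F (\<lambda>z. c * z) sequentially)"
proof
  assume lim: "\<forall>K. compact K \<longrightarrow> K \<subseteq> unit_disc \<longrightarrow> uniform_limit K F (\<lambda>z. c * z) sequentially"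
  obtain g where g: "g \<in> Hol X A" "\<And>z. norm z < 1 \<Longrightarrow> g (p z) = p (c * z)"
    "limitin (Hol_topology X A) f g sequentially"
  proof (rule lifts_converge[of f F "\<lambda>z. c * z"])
    show "(\<lambda>z. c * z) holomorphic_on unit_disc" "(\<lambda>z. c * z) \<in> unit_disc \<rightarrow> unit_disc"
      using c by (auto intro!: holomorphic_intros simp: norm_mult)
  qed (use f \<F> F lim in auto)
  have "g \<in> Hol_topology X A closure_of \<F>"
    unfolding in_closure_of
  proof (intro conjI allI impI)
    fix T assume T: "g \<in> T \<and> openin (Hol_topology X A) T"
    then obtain N where "\<forall>n\<ge>N. f n \<in> T"
      using g(3) unfolding limitin_sequentially by metis
    then show "\<exists>h. h \<in> \<F> \<and> h \<in> T"
      using f by blast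
  qed (use g(1) in simp)
  then show False
    using aperiodic rotation_lift_imp_periodic_or_pseudoperiodic[OF g(1,2) c] by blast
qed

lemma left_ifs_converges_to_base_point:
  assumes \<F>: "\<F> \<subseteq> Hol X A"
    and aperiodic: "\<forall>g \<in> Hol_topology X A closure_of \<F>.
       \<not> periodic_automorphism X A g \<and> \<not> pseudoperiodic_automorphism X A g"
    and f: "\<And>n. n \<ge> 1 \<Longrightarrow> f n \<in> \<F>"
    and compact: "compactin (Hol_topology X A)
       (Hol_topology X A closure_of ((\<lambda>n. left_ifs X f n) ` {1..}))"
    and \<alpha>: "\<And>n. n \<ge> 1 \<Longrightarrow> \<alpha> n \<in> X \<and> f n (\<alpha> n) = \<alpha> n"
    and lim: "limitin (top_of_set X) \<alpha> (p 0) sequentially"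
  shows "limitin (Hol_topology X A) (\<lambda>n. left_ifs X f n) (\<lambda>x\<in>X. p 0) sequentially"
proof -
  have f_Hol: "f n \<in> Hol X A" if "n \<ge> 1" for n
    using f[OF that] \<F> by blast
  \<comment> \<open>Indices are shifted by one, since the system starts with \<open>f 1\<close>.\<close>
  have "limitin (top_of_set X) (\<lambda>n. \<alpha> (Suc n)) (p 0) sequentially"
    using limitin_sequentially_offset[OF lim, of 1] by simp
  then obtain b where b: "\<And>n. norm (b n) < 1" "\<And>n. p (b n) = \<alpha> (Suc n)" "b \<longlonglongrightarrow> 0"
    using convergent_sequence_lift[of "\<lambda>n. \<alpha> (Suc n)" 0] \<alpha> by auto
  have "\<forall>n. \<exists>F. F holomorphic_on unit_disc \<and> F (b n) = b n \<and>
      (\<forall>w. norm w < 1 \<longrightarrow> norm (F w) < 1 \<and> p (F w) = f (Suc n) (p w))"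
    using self_map_lift_fixing_point[OF f_Hol b(1)] \<alpha> b(2) by simp
  then obtain F where F: "\<And>n. F n holomorphic_on unit_disc" "\<And>n. F n (b n) = b n"
    "\<And>n w. norm w < 1 \<Longrightarrow> norm (F n w) < 1" "\<And>n w. norm w < 1 \<Longrightarrow> p (F n w) = f (Suc n) (p w)"
    by metis
  have no_rotation: "\<not> (\<forall>K. compact K \<longrightarrow> K \<subseteq> unit_disc \<longrightarrow>
      uniform_limit K (\<lambda>j. F (s j)) (\<lambda>z. c * z) sequentially)" if "norm c = 1" for s c
    by (rule no_rotation_is_limit_of_lifts[OF _ \<F> aperiodic, of "\<lambda>j. f (Suc (s j))"])
       (use f F that in auto)
  have L_Hol: "left_ifs X f n \<in> Hol X A" for n
    using left_ifs_in_Hol f_Hol .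
  have "(\<lambda>x\<in>X. p 0) \<in> Hol X A"
  proof (rule HolI_lift)
    have "holomorphic_map unit_disc unit_disc_atlas X A (\<lambda>z. p 0)"
      using holomorphic_map_disc_reparametrize[of "\<lambda>z. 0"] by simp
    then show "holomorphic_map unit_disc unit_disc_atlas X A (\<lambda>z. (\<lambda>x\<in>X. p 0) (p z))"
      by (rule holomorphic_map_disc_cong) (simp add: p_in)
  qed simp
  then show ?thesis
  proof (rule limitin_Hol_topologyI)
    fix K U assume K: "compact K" "K \<subseteq> X" and U: "openin (top_of_set X) U" "(\<lambda>x\<in>X. p 0) ` K \<subseteq> U"
    show "\<forall>\<^sub>F n in sequentially. left_ifs X f n ` K \<subseteq> U"
    proof (cases "K = {}")
      case False
      then have "p 0 \<in> U"
        using U(2) K(2) by auto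
      obtain r where r: "0 < r" "r < 1" "\<And>g. g \<in> left_ifs X f ` {1..} \<Longrightarrow> g ` K \<subseteq> p ` ball 0 r"
        using relatively_compact_images_in_small_disc[OF compact _ K] L_Hol by blast
      have "open (unit_disc \<inter> p -` U)"
        using open_vimage_disc[OF continuous_p _ U(1)] p_in by auto
      moreover have "0 \<in> unit_disc \<inter> p -` U"
        using \<open>p 0 \<in> U\<close> by simp
      ultimately obtain e where e: "e > 0" "cball 0 e \<subseteq> unit_disc \<inter> p -` U"
        using open_contains_cball_eq[of "unit_disc \<inter> p -` U"] by blast
      \<comment> \<open>With \<open>\<epsilon> \<le> r\<close> the lifted points never leave the disc of radius \<open>r\<close>, where the contraction applies.\<close>
      define \<epsilon> where "\<epsilon> = min e r"
      have \<epsilon>: "0 < \<epsilon>" "\<epsilon> \<le> r" "p ` cball 0 \<epsilon> \<subseteq> U"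
        using e r(1) by (auto simp: \<epsilon>_def)
      obtain \<eta> N where \<eta>: "\<eta> > 0"
        and contract: "\<And>n z. n \<ge> N \<Longrightarrow> norm z \<le> r \<Longrightarrow> norm (F n z) \<le> max \<epsilon> (norm z - \<eta>)"
        by (rule eventually_uniform_contraction[OF F(1,3,2) b(3) no_rotation r(2) \<epsilon>(1)]) (assumption | rule that)+
      \<comment> \<open>Each step lowers the radius by \<open>\<eta>\<close> until it reaches \<open>\<epsilon>\<close>.\<close>
      have shrink: "left_ifs X f (Suc N + j) ` K \<subseteq> p ` cball 0 (max \<epsilon> (r - j * \<eta>))" for j
      proof (induction j)
        case 0
        have "left_ifs X f (Suc N) ` K \<subseteq> p ` ball 0 r"
          by (intro r(3) imageI) simp
        also have "\<dots> \<subseteq> p ` cball 0 (max \<epsilon> r)"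
          by auto
        finally show ?case by simp
      next
        case (Suc j)
        show ?case
        proof clarify
          fix x assume x: "x \<in> K"
          then obtain z where z: "norm z \<le> max \<epsilon> (r - j * \<eta>)" "left_ifs X f (Suc N + j) x = p z"
            using Suc by auto
          have "0 \<le> j * \<eta>"
            using \<eta> by simp
          then have zr: "norm z \<le> r"
            using z(1) \<epsilon>(2) by linarith
          have step: "left_ifs X f (Suc m) x = f (Suc m) (left_ifs X f m x)" for m
            using x K(2) by (auto simp: compose_def)
          have "left_ifs X f (Suc N + Suc j) x = f (Suc (Suc N + j)) (p z)"
            unfolding add_Suc_right step z(2) ..
          also have "\<dots> = p (F (Suc N + j) z)"
            using F(4) zr r(2) by simp
          finally have "left_ifs X f (Suc N + Suc j) x = p (F (Suc N + j) z)" .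
          moreover have "norm (F (Suc N + j) z) \<le> max \<epsilon> (norm z - \<eta>)"
            using contract zr by simp
          then have "norm (F (Suc N + j) z) \<le> max \<epsilon> (r - Suc j * \<eta>)"
            using z(1) \<eta> by (auto simp: algebra_simps)
          ultimately show "left_ifs X f (Suc N + Suc j) x \<in> p ` cball 0 (max \<epsilon> (r - Suc j * \<eta>))"
            by auto
        qed
      qed
      obtain J :: nat where J: "r < J * \<eta>"
        using \<eta> reals_Archimedean3 by blast
      have "left_ifs X f n ` K \<subseteq> U" if "n \<ge> Suc N + J" for n
      proof -
        define j where "j = n - Suc N"
        have j: "n = Suc N + j" "j \<ge> J"
          using that by (auto simp: j_def)
        have "J * \<eta> \<le> j * \<eta>"
          using j(2) \<eta> by simp
        then have "max \<epsilon> (r - j * \<eta>) = \<epsilon>"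
          using J \<epsilon>(1) by linarith
        then show ?thesis
          using shrink[of j] \<epsilon>(3) j(1) by auto
      qed
      then show ?thesis
        unfolding eventually_sequentially by blast
    qed simp
  qed (rule L_Hol)
qed

end

text \<open>An automorphism of the disc moves \<open>0\<close> to a given preimage of \<open>a\<close>.\<close>

lemma disc_uniformization_with_base_point:
  assumes X: "hyperbolic_surface X A" and a: "a \<in> X"
  obtains p where "disc_uniformization X A p" "p 0 = a"
proof -
  obtain p where surface: "riemann_surface X A" and cov: "covering_space unit_disc p X"
    and hol: "holomorphic_map unit_disc unit_disc_atlas X A p"
    using X unfolding hyperbolic_surface_def by blast
  interpret disc_uniformization X A p
    using surface cov hol by unfold_locales
  obtain b where b: "norm b < 1" "p b = a"
    using lift_point[OF a] .
  obtain k h where "k b = 0"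
    and k: "k holomorphic_on unit_disc" "k ` unit_disc \<subseteq> unit_disc"
    and h: "h holomorphic_on unit_disc" "h ` unit_disc \<subseteq> unit_disc"
    and inv: "\<And>z. z \<in> unit_disc \<Longrightarrow> k (h z) = z" "\<And>z. z \<in> unit_disc \<Longrightarrow> h (k z) = z"
    using ball_biholomorphism_exists[of b] b(1) by (metis mem_ball_0)
  have "homeomorphism unit_disc unit_disc h k"
    using h k inv by (intro homeomorphismI) (auto intro: holomorphic_on_imp_continuous_on)
  then have "disc_uniformization X A (\<lambda>z. p (h z))"
    using surface covering_space_compose_homeomorphism[OF cov] holomorphic_map_disc_reparametrize h
    by unfold_locales blast+
  moreover have "p (h 0) = a"
    using inv(2)[of b] b \<open>k b = 0\<close> by simp
  ultimately show thesis
    by (rule that)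
qed

theorem theoremI:
  fixes X :: "'a::topological_space set"
    and A :: "'a complex_atlas"
    and \<F> :: "('a \<Rightarrow> 'a) set"
    and f :: "nat \<Rightarrow> 'a \<Rightarrow> 'a"
    and \<alpha> :: "nat \<Rightarrow> 'a"
    and a :: 'a
  assumes "hyperbolic_surface X A"
    and "\<F> \<subseteq> Hol X A"
    and "\<forall>g \<in> Hol_topology X A closure_of \<F>.
           \<not> periodic_automorphism X A g \<and> \<not> pseudoperiodic_automorphism X A g"
    and "\<forall>n\<ge>1. f n \<in> \<F>"
    and "compactin (Hol_topology X A)
           (Hol_topology X A closure_of ((\<lambda>n. left_ifs X f n) ` {1..}))"
    and "\<forall>n\<ge>1. \<alpha> n \<in> X \<and> f n (\<alpha> n) = \<alpha> n"
    and "a \<in> X"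
    and "limitin (top_of_set X) \<alpha> a sequentially"
  shows "limitin (Hol_topology X A) (\<lambda>n. left_ifs X f n) (\<lambda>x\<in>X. a) sequentially"
proof -
  obtain p where "disc_uniformization X A p" and p0: "p 0 = a"
    using disc_uniformization_with_base_point assms(1,7) by blast
  then interpret disc_uniformization X A p
    by simp
  show ?thesis
    using left_ifs_converges_to_base_point[of \<F> f \<alpha>] assms(2-6,8) unfolding p0 by blast
qed

end
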